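(* Let $n\ge 2$, let $m_0$ and $d$ be positive integers, and let $m_i=m_0+id$ for $0\le i\le n$ be an arithmetic sequence with $\gcd(m_0,\ldots,m_n)=1$ that minimally generates the numerical semigroup $\sum_{i=0}^n\mathbb{N}_0 m_i$. Let $F$ be a field, let $P\subseteq F[x_0,\ldots,x_n]$ be the defining ideal corresponding to $m_0,\ldots,m_n$, and let $\mathrm{in}P$ be its initial ideal with respect to the weighted grevlex order described in the context. Then $(\mathrm{in}P)^l$ is Ratliff-Rush for all positive integers $l$.
   Context: $P$ is the kernel of the $F$-algebra homomorphism $\eta:F[x_0,\ldots,x_n]\to F[t]$, $\eta(x_i)=t^{m_i}$. Here $\mathbb{N}_0=\mathbb{N}\cup\{0\}$. The monomial order is grevlex with the grading $wt(x_i)=m_i$ and $x_0<x_1<\cdots<x_n$: monomials are first compared by weighted degree, and for two monomials of equal weighted degree $\prod_{i=0}^n x_i^{a_i}>\prod_{i=0}^n x_i^{b_i}$ if the left-most nonzero entry of $(a_0-b_0,a_1-b_1,\ldots,a_n-b_n)$ is negative. $\mathrm{in}P$ is the ideal generated by the leading monomials of the nonzero elements of $P$. For a regular ideal $I$ (one containing a nonzerodivisor) of a commutative Noetherian ring $R$, its Ratliff-Rush closure is $\widetilde{I}=\bigcup_{n\ge 1}(I^{n+1}:I^{n})$, where $I^{n+1}:I^n=\{z\in R\mid zI^n\subseteq I^{n+1}\}$; $I$ is Ratliff-Rush if $I=\widetilde{I}$. *)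

theory Defs
  imports
    "HOL-Computational_Algebra.Polynomial"
    "HOL-Library.Poly_Mapping"
    "HOL-Algebra.Ideal_Product"
    "HOL-Algebra.RingHom"
begin

section \<open>Ratliff-Rush ideals\<close>

definition nonzerodivisor :: "('a, 'b) ring_scheme \<Rightarrow> 'a \<Rightarrow> bool" where
  "nonzerodivisor R x \<longleftrightarrow>
     x \<in> carrier R \<and> (\<forall>y \<in> carrier R. x \<otimes>\<^bsub>R\<^esub> y = \<zero>\<^bsub>R\<^esub> \<longrightarrow> y = \<zero>\<^bsub>R\<^esub>)"

definition regular_ideal :: "('a, 'b) ring_scheme \<Rightarrow> 'a set \<Rightarrow> bool" where
  "regular_ideal R I \<longleftrightarrow> ideal I R \<and> (\<exists>x \<in> I. nonzerodivisor R x)"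

definition colon :: "('a, 'b) ring_scheme \<Rightarrow> 'a set \<Rightarrow> 'a set \<Rightarrow> 'a set" where
  "colon R I J = {z \<in> carrier R. \<forall>x \<in> J. z \<otimes>\<^bsub>R\<^esub> x \<in> I}"

abbreviation ideal_pow :: "('a, 'b) ring_scheme \<Rightarrow> 'a set \<Rightarrow> nat \<Rightarrow> 'a set" where
  "ideal_pow R I k \<equiv> I [^]\<^bsub>ideals_set R\<^esub> k"

definition ratliff_rush_closure :: "('a, 'b) ring_scheme \<Rightarrow> 'a set \<Rightarrow> 'a set" where
  "ratliff_rush_closure R I = (\<Union>k \<in> {1..}. colon R (ideal_pow R I (k + 1)) (ideal_pow R I k))"

text \<open>The notion is only used for regular ideals, so regularity is part of it.\<close>

definition ratliff_rush :: "('a, 'b) ring_scheme \<Rightarrow> 'a set \<Rightarrow> bool" where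
  "ratliff_rush R I \<longleftrightarrow> regular_ideal R I \<and> I = ratliff_rush_closure R I"


section \<open>Polynomial rings\<close>

text \<open>
  An exponent vector is a finitely supported function from variable indices to exponents. The
  type below has a variable \<open>x\<^sub>i\<close> for every natural number \<open>i\<close>; the ring
  \<open>F[x\<^sub>0,\<dots>,x\<^sub>n]\<close> is cut out by its carrier, so that \<open>n\<close> can be an ordinary variable.
\<close>

type_synonym 'a mpoly = "(nat \<Rightarrow>\<^sub>0 nat) \<Rightarrow>\<^sub>0 'a"

definition ring_on :: "'a::comm_ring_1 set \<Rightarrow> 'a ring" where
  "ring_on A = \<lparr>carrier = A, mult = (*), one = 1, zero = 0, add = (+)\<rparr>"

definition mpoly_ring :: "nat \<Rightarrow> 'a::field mpoly ring" where
  "mpoly_ring n = ring_on {p. \<forall>a \<in> Poly_Mapping.keys p. Poly_Mapping.keys a \<subseteq> {..n}}"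

definition upoly_ring :: "'a::field poly ring" where
  "upoly_ring = ring_on UNIV"


section \<open>The defining ideal\<close>

text \<open>Substitution of \<open>t ^ m i\<close> for \<open>x\<^sub>i\<close>; see \<open>eta_in_ring_hom\<close>, \<open>eta_const\<close> and \<open>eta_var\<close>.\<close>

definition eta :: "(nat \<Rightarrow> nat) \<Rightarrow> 'a::field mpoly \<Rightarrow> 'a poly" where
  "eta m p = (\<Sum>a \<in> Poly_Mapping.keys p. smult (Poly_Mapping.lookup p a) (\<Prod>i \<in> Poly_Mapping.keys a. (monom 1 (m i)) ^ Poly_Mapping.lookup a i))"

definition defining_ideal :: "nat \<Rightarrow> (nat \<Rightarrow> nat) \<Rightarrow> 'a::field mpoly set" where
  "defining_ideal n m = a_kernel (mpoly_ring n) upoly_ring (eta m)"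


section \<open>The initial ideal\<close>

definition wdeg :: "(nat \<Rightarrow> nat) \<Rightarrow> (nat \<Rightarrow>\<^sub>0 nat) \<Rightarrow> nat" where
  "wdeg m a = (\<Sum>i \<in> Poly_Mapping.keys a. Poly_Mapping.lookup a i * m i)"

text \<open>
  In the second disjunct \<open>i\<close> is the left-most index where the exponent vectors differ, and the
  larger monomial is the one with the smaller exponent there.
\<close>

definition grevlex_less :: "(nat \<Rightarrow> nat) \<Rightarrow> (nat \<Rightarrow>\<^sub>0 nat) \<Rightarrow> (nat \<Rightarrow>\<^sub>0 nat) \<Rightarrow> bool" where
  "grevlex_less m b a \<longleftrightarrow>
     wdeg m b < wdeg m a \<or>
     (wdeg m b = wdeg m a \<and>
      (\<exists>i. Poly_Mapping.lookup a i < Poly_Mapping.lookup b i \<and> (\<forall>j < i. Poly_Mapping.lookup a j = Poly_Mapping.lookup b j)))"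

definition is_leading_exponent :: "(nat \<Rightarrow> nat) \<Rightarrow> 'a::field mpoly \<Rightarrow> (nat \<Rightarrow>\<^sub>0 nat) \<Rightarrow> bool" where
  "is_leading_exponent m p a \<longleftrightarrow>
     a \<in> Poly_Mapping.keys p \<and> (\<forall>b \<in> Poly_Mapping.keys p. b \<noteq> a \<longrightarrow> grevlex_less m b a)"

definition initial_ideal :: "nat \<Rightarrow> (nat \<Rightarrow> nat) \<Rightarrow> 'a::field mpoly set \<Rightarrow> 'a mpoly set" where
  "initial_ideal n m I =
     genideal (mpoly_ring n)
       {Poly_Mapping.single a 1 | a. \<exists>p \<in> I. p \<noteq> 0 \<and> is_leading_exponent m p a}"


section \<open>Numerical semigroups\<close>

definition semigroup_gen :: "(nat \<Rightarrow> nat) \<Rightarrow> nat set \<Rightarrow> nat set" where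
  "semigroup_gen m J = {\<Sum>i \<in> J. c i * m i | c :: nat \<Rightarrow> nat. True}"

definition minimally_generates :: "(nat \<Rightarrow> nat) \<Rightarrow> nat set \<Rightarrow> nat set \<Rightarrow> bool" where
  "minimally_generates m J S \<longleftrightarrow>
     semigroup_gen m J = S \<and> (\<forall>K. K \<subset> J \<longrightarrow> semigroup_gen m K \<noteq> S)"


section \<open>Basic facts\<close>

lemma cring_ring_on:
  assumes "0 \<in> A" "1 \<in> A"
    and "\<And>x y. x \<in> A \<Longrightarrow> y \<in> A \<Longrightarrow> x + y \<in> A"
    and "\<And>x y. x \<in> A \<Longrightarrow> y \<in> A \<Longrightarrow> x * y \<in> A"
    and "\<And>x. x \<in> A \<Longrightarrow> - x \<in> A"
  shows "cring (ring_on A)"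
proof (rule cringI)
  show "abelian_group (ring_on A)"
    by (rule abelian_groupI)
       (use assms in \<open>auto simp: ring_on_def algebra_simps intro!: bexI[of _ "- _"]\<close>)
  show "comm_monoid (ring_on A)"
    by (rule comm_monoidI) (use assms in \<open>auto simp: ring_on_def algebra_simps\<close>)
qed (auto simp: ring_on_def algebra_simps)

lemma keys_add_exponents: "Poly_Mapping.keys (a + b) = Poly_Mapping.keys a \<union> Poly_Mapping.keys (b :: nat \<Rightarrow>\<^sub>0 nat)"
  by (auto simp: in_keys_iff lookup_add)

lemma cring_mpoly_ring: "cring (mpoly_ring n :: 'a::field mpoly ring)"
  unfolding mpoly_ring_def
proof (rule cring_ring_on, goal_cases)
  case (3 x y)
  then show ?case using keys_add[of x y] by blast
next
  case (4 x y)
  then show ?case using keys_mult[of x y] by (fastforce simp: keys_add_exponents)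
qed auto

lemma cring_upoly_ring: "cring (upoly_ring :: 'a::field poly ring)"
  unfolding upoly_ring_def by (rule cring_ring_on) auto

lemma eta_superset:
  assumes "finite A" "Poly_Mapping.keys p \<subseteq> A"
  shows "eta m p = (\<Sum>a \<in> A. monom (Poly_Mapping.lookup p a) (wdeg m a))"
proof -
  have *: "(\<Prod>i \<in> K. (monom 1 (m i)) ^ Poly_Mapping.lookup a i) = (monom 1 (\<Sum>i \<in> K. Poly_Mapping.lookup a i * m i) :: 'a poly)"
    if "finite K" for a K
    using that by (induction rule: finite_induct) (auto simp: monom_power mult_monom mult.commute)
  have "eta m p = (\<Sum>a \<in> Poly_Mapping.keys p. monom (Poly_Mapping.lookup p a) (wdeg m a))"
    by (simp add: eta_def wdeg_def * smult_monom)
  also have "\<dots> = (\<Sum>a \<in> A. monom (Poly_Mapping.lookup p a) (wdeg m a))"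
    by (rule sum.mono_neutral_left) (use assms in \<open>auto simp: in_keys_iff\<close>)
  finally show ?thesis .
qed

lemma eta_single: "eta m (Poly_Mapping.single a c) = monom c (wdeg m a)"
  using eta_superset[of "{a}" "Poly_Mapping.single a c" m] by simp

lemma eta_const: "eta m (Poly_Mapping.single 0 c) = [:c:]"
  by (simp add: eta_single wdeg_def monom_0)

lemma eta_var: "eta m (Poly_Mapping.single (Poly_Mapping.single i 1) 1) = monom 1 (m i)"
  by (simp add: eta_single wdeg_def)

lemma eta_add: "eta m (p + q) = eta m p + eta m q"
proof -
  let ?A = "Poly_Mapping.keys p \<union> Poly_Mapping.keys q"
  have "Poly_Mapping.keys (p + q) \<subseteq> ?A" by (rule keys_add)
  then show ?thesis
    using eta_superset[of ?A "p + q" m] eta_superset[of ?A p m] eta_superset[of ?A q m]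
    by (simp add: lookup_add add_monom [symmetric] sum.distrib)
qed

lemma wdeg_add: "wdeg m (a + b) = wdeg m a + wdeg m b"
proof -
  have *: "wdeg m c = (\<Sum>i \<in> Poly_Mapping.keys a \<union> Poly_Mapping.keys b. Poly_Mapping.lookup c i * m i)" if "Poly_Mapping.keys c \<subseteq> Poly_Mapping.keys a \<union> Poly_Mapping.keys b" for c
    unfolding wdeg_def by (rule sum.mono_neutral_left) (use that in \<open>auto simp: in_keys_iff\<close>)
  show ?thesis
    by (simp add: * keys_add_exponents lookup_add sum.distrib algebra_simps)
qed

lemma mpoly_single_add_induct [case_names single sum]:
  fixes p :: "'a::field mpoly"
  assumes single: "\<And>a c. Q (Poly_Mapping.single a c)"
    and sum: "\<And>r s. Q r \<Longrightarrow> Q s \<Longrightarrow> Q (r + s)"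
  shows "Q p"
proof (induction p rule: update_induct)
  case const
  show ?case using single[of 0 0] by simp
next
  case (update f a b)
  then have "Poly_Mapping.update a b f = f + Poly_Mapping.single a b"
    by (intro poly_mapping_eqI)
       (auto simp: lookup_update lookup_add lookup_single when_def in_keys_iff)
  then show ?case using update single sum by simp
qed

lemma eta_mult: "eta m (p * q) = eta m p * eta m q"
proof (induction p rule: mpoly_single_add_induct)
  case (single a c)
  show ?case
  proof (induction q rule: mpoly_single_add_induct)
    case (single b e)
    show ?case by (simp add: mult_single eta_single mult_monom wdeg_add)
  next
    case (sum r s)
    then show ?case by (simp add: eta_add distrib_left)
  qed
next
  case (sum r s)
  then show ?case by (simp add: eta_add distrib_right)
qed

lemma eta_in_ring_hom: "eta m \<in> ring_hom (mpoly_ring n) upoly_ring"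
proof (rule ring_hom_memI)
  show "eta m \<one>\<^bsub>mpoly_ring n\<^esub> = \<one>\<^bsub>upoly_ring\<^esub>"
    using eta_const[of m 1] by (simp add: one_pCons mpoly_ring_def upoly_ring_def ring_on_def)
qed (auto simp: mpoly_ring_def upoly_ring_def ring_on_def eta_add eta_mult)

lemma ideal_defining_ideal: "ideal (defining_ideal n m) (mpoly_ring n)"
  unfolding defining_ideal_def
  by (rule ring_hom_ring.kernel_is_ideal, rule ring_hom_ringI2)
     (auto intro: cring.axioms(1) cring_mpoly_ring cring_upoly_ring eta_in_ring_hom)

lemma ideal_initial_ideal:
  assumes "I \<subseteq> carrier (mpoly_ring n)"
  shows "ideal (initial_ideal n m I) (mpoly_ring n)"
  unfolding initial_ideal_def
proof (rule ring.genideal_ideal[OF cring.axioms(1)[OF cring_mpoly_ring]])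
  show "{Poly_Mapping.single a 1 | a. \<exists>p \<in> I. p \<noteq> 0 \<and> is_leading_exponent m p a}
          \<subseteq> carrier (mpoly_ring n)"
    using assms by (fastforce simp: mpoly_ring_def ring_on_def is_leading_exponent_def)
qed

lemma grevlex_less_total: "a \<noteq> b \<Longrightarrow> grevlex_less m a b \<or> grevlex_less m b a"
proof -
  assume "a \<noteq> b"
  then have "\<exists>i. Poly_Mapping.lookup a i \<noteq> Poly_Mapping.lookup b i" by (metis poly_mapping_eqI)
  then obtain i where "Poly_Mapping.lookup a i \<noteq> Poly_Mapping.lookup b i" "\<forall>j < i. Poly_Mapping.lookup a j = Poly_Mapping.lookup b j"
    by (metis exists_least_iff[of "\<lambda>i. Poly_Mapping.lookup a i \<noteq> Poly_Mapping.lookup b i"])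
  then show ?thesis
    unfolding grevlex_less_def by (metis nat_neq_iff)
qed

lemma grevlex_less_irrefl: "\<not> grevlex_less m a a"
  by (simp add: grevlex_less_def)

lemma grevlex_less_trans: "grevlex_less m a b \<Longrightarrow> grevlex_less m b c \<Longrightarrow> grevlex_less m a c"
proof -
  have *: "\<exists>k. Poly_Mapping.lookup c k < Poly_Mapping.lookup a k \<and> (\<forall>l < k. Poly_Mapping.lookup c l = Poly_Mapping.lookup a l)"
    if "Poly_Mapping.lookup b i < Poly_Mapping.lookup a i" "\<forall>l < i. Poly_Mapping.lookup b l = Poly_Mapping.lookup a l"
       "Poly_Mapping.lookup c j < Poly_Mapping.lookup b j" "\<forall>l < j. Poly_Mapping.lookup c l = Poly_Mapping.lookup b l" for i j
    using that by (intro exI[of _ "min i j"]) (cases i j rule: linorder_cases; auto)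
  assume "grevlex_less m a b" "grevlex_less m b c"
  then show ?thesis
    unfolding grevlex_less_def using * by (smt (verit, best) less_trans)
qed

lemma leading_exponent_exists:
  assumes "p \<noteq> 0"
  shows "\<exists>!a. is_leading_exponent m p a"
proof -
  have "\<exists>a \<in> K. \<forall>b \<in> K. b \<noteq> a \<longrightarrow> grevlex_less m b a" if "finite K" "K \<noteq> {}" for K
    using that
  proof (induction rule: finite_ne_induct)
    case (singleton x)
    then show ?case by simp
  next
    case (insert x K)
    then obtain a where "a \<in> K" "\<forall>b \<in> K. b \<noteq> a \<longrightarrow> grevlex_less m b a" by blast
    then show ?case
      using grevlex_less_total[of a x m] grevlex_less_trans[of m _ a x] by (metis insertE insertCI)
  qed
  from this[of "Poly_Mapping.keys p"] assms have "\<exists>a. is_leading_exponent m p a"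
    by (auto simp: is_leading_exponent_def)
  then show ?thesis
    unfolding is_leading_exponent_def using grevlex_less_trans grevlex_less_irrefl by metis
qed

end

theory Submission
  imports Defs "HOL-Number_Theory.Cong"
begin

text \<open>
  Write \<open>m0 = q n + r\<close> with \<open>1 \<le> r \<le> n\<close>. Minimal generation forces \<open>n < m0\<close>, so \<open>q > 0\<close>.

  The initial ideal of \<open>P\<close> is the monomial ideal \<open>I\<close> generated by the products \<open>x\<^sub>i x\<^sub>j\<close> with
  \<open>1 \<le> i \<le> j < n\<close> and the products \<open>x\<^sub>i x\<^sub>n\<^sup>q\<close> with \<open>r \<le> i \<le> n\<close>. These are leading monomials of the
  binomials \<open>x\<^sub>i x\<^sub>j - x\<^bsub>i-1\<^esub> x\<^bsub>j+1\<^esub>\<close> and \<open>x\<^sub>i x\<^sub>n\<^sup>q - x\<^bsub>i-r\<^esub> x\<^sub>0\<^bsup>q+d\<^esup>\<close> of \<open>P\<close>. Conversely, every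
  leading monomial lies in \<open>I\<close>: a monomial outside \<open>I\<close> has the form \<open>x\<^sub>0\<^sup>e x\<^sub>j x\<^sub>n\<^sup>s\<close> (with \<open>j = 0\<close> standing for an absent
  middle factor) where \<open>j + n s < m0\<close>, and as its weight is congruent to \<open>(j + n s) d\<close> modulo \<open>m0\<close>
  with \<open>d\<close> prime to \<open>m0\<close>, it is determined by its weight. Every leading monomial of
  an element of \<open>P\<close> has a smaller monomial of the same weight, and the smallest monomial of each
  weight lies outside \<open>I\<close> by the reductions given by the binomials; hence the leading monomial
  itself lies in \<open>I\<close> (\<open>leading_exponents_eq\<close>).

  Membership of a monomial in \<open>I\<^sup>l\<close> is a system of linear inequalities between its degree in
  \<open>x\<^sub>1, \<dots>, x\<^bsub>n-1\<^esub>\<close>, its degree in \<open>x\<^sub>r, \<dots>, x\<^bsub>n-1\<^esub>\<close> and its exponent at \<open>x\<^sub>n\<close>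
  (\<open>pow_exps\<close>, \<open>ideal_pow_monomial_ideal_pow_exps\<close>). From these inequalities one reads off that
  \<open>I\<^bsup>l+1\<^esup> : x\<^sub>n\<^bsup>q+1\<^esup> = I\<^sup>l\<close> for all \<open>l\<close> (\<open>pow_exps_cancel\<close>). If \<open>z\<close> multiplies \<open>I\<^bsup>lk\<^esup>\<close> into
  \<open>I\<^bsup>l+lk\<^esup>\<close>, then in particular \<open>z x\<^sub>n\<^bsup>(q+1)lk\<^esup>\<close> lies in \<open>I\<^bsup>l+lk\<^esup>\<close>, and cancelling \<open>x\<^sub>n\<^bsup>q+1\<^esup>\<close> a
  total of \<open>lk\<close> times gives \<open>z \<in> I\<^sup>l\<close>.
\<close>

section \<open>Monomial ideals\<close>

definition up_closed :: "nat \<Rightarrow> (nat \<Rightarrow>\<^sub>0 nat) set \<Rightarrow> bool" where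
  "up_closed n A \<longleftrightarrow>
     (\<forall>a \<in> A. Poly_Mapping.keys a \<subseteq> {..n}) \<and>
     (\<forall>a \<in> A. \<forall>b. Poly_Mapping.keys b \<subseteq> {..n} \<longrightarrow> a + b \<in> A)"

definition monomial_ideal :: "(nat \<Rightarrow>\<^sub>0 nat) set \<Rightarrow> 'a::field mpoly set" where
  "monomial_ideal A = {p. Poly_Mapping.keys p \<subseteq> A}"

lemma mpoly_ring_simps:
  "carrier (mpoly_ring n) = {p. \<forall>a \<in> Poly_Mapping.keys p. Poly_Mapping.keys a \<subseteq> {..n}}"
  "x \<otimes>\<^bsub>mpoly_ring n\<^esub> y = x * y" "x \<oplus>\<^bsub>mpoly_ring n\<^esub> y = x + y"
  "\<zero>\<^bsub>mpoly_ring n\<^esub> = 0" "\<one>\<^bsub>mpoly_ring n\<^esub> = 1"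
  by (simp_all add: mpoly_ring_def ring_on_def)

lemma monomial_ideal_exponents:
  "monomial_ideal {a. Poly_Mapping.keys a \<subseteq> {..n}} = carrier (mpoly_ring n)"
  by (auto simp: monomial_ideal_def mpoly_ring_simps)

lemma monomial_ideal_subset_carrier:
  "up_closed n A \<Longrightarrow> monomial_ideal A \<subseteq> carrier (mpoly_ring n)"
  by (auto simp: monomial_ideal_def mpoly_ring_simps up_closed_def)

lemma single_in_monomial_ideal: "a \<in> A \<Longrightarrow> Poly_Mapping.single a c \<in> monomial_ideal A"
  by (simp add: monomial_ideal_def)

text \<open>
  Additive closure reduces statements about a monomial ideal to its terms, which is how both the
  generated ideal and the ideal product below are compared with monomial ideals.
\<close>

lemma monomial_ideal_induct [consumes 1, case_names zero single add]:
  assumes "p \<in> monomial_ideal A"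
    and "Q 0"
    and "\<And>a c. a \<in> A \<Longrightarrow> Q (Poly_Mapping.single a c)"
    and "\<And>p q. Q p \<Longrightarrow> Q q \<Longrightarrow> Q (p + q)"
  shows "Q p"
proof -
  have "Poly_Mapping.keys p \<subseteq> A \<longrightarrow> Q p"
  proof (induction p rule: update_induct)
    case const
    show ?case using assms(2) by simp
  next
    case (update f a b)
    then have "Poly_Mapping.update a b f = f + Poly_Mapping.single a b"
      by (intro poly_mapping_eqI)
        (auto simp: lookup_update lookup_add lookup_single when_def in_keys_iff)
    moreover have "Poly_Mapping.keys (Poly_Mapping.update a b f)
        = insert a (Poly_Mapping.keys f)"
      using update by (auto simp: in_keys_iff lookup_update split: if_splits)
    ultimately show ?case using update assms(3,4) by auto
  qed
  then show ?thesis using assms(1) by (simp add: monomial_ideal_def)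
qed

lemma times_in_monomial_ideal:
  assumes "up_closed n A" "p \<in> monomial_ideal A" "x \<in> carrier (mpoly_ring n)"
  shows "x * p \<in> monomial_ideal A"
  unfolding monomial_ideal_def
proof (rule CollectI, rule subsetI)
  fix c assume "c \<in> Poly_Mapping.keys (x * p)"
  then obtain b a where "c = b + a" "b \<in> Poly_Mapping.keys x" "a \<in> Poly_Mapping.keys p"
    using keys_mult[of x p] by blast
  then show "c \<in> A"
    using assms
    by (auto simp: monomial_ideal_def mpoly_ring_simps up_closed_def add.commute[of b])
qed

lemma ideal_monomial_ideal:
  assumes "up_closed n A"
  shows "ideal (monomial_ideal A :: 'a::field mpoly set) (mpoly_ring n)"
proof -
  let ?R = "mpoly_ring n :: 'a mpoly ring"
  let ?I = "monomial_ideal A :: 'a mpoly set"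
  interpret R: cring ?R by (rule cring_mpoly_ring)
  have minus: "\<ominus>\<^bsub>?R\<^esub> x = - x" if "x \<in> carrier ?R" for x
    by (rule R.minus_equality) (use that in \<open>auto simp: mpoly_ring_simps\<close>)
  show ?thesis
  proof (rule idealI)
    show "ring ?R" by (rule R.ring_axioms)
    show "subgroup ?I (add_monoid ?R)"
    proof (rule R.add.subgroupI)
      show "?I \<subseteq> carrier ?R" by (rule monomial_ideal_subset_carrier) fact
      show "?I \<noteq> {}" by (auto simp: monomial_ideal_def intro!: exI[of _ 0])
      show "\<ominus>\<^bsub>?R\<^esub> p \<in> ?I" if "p \<in> ?I" for p
        using that minus[of p] subsetD[OF monomial_ideal_subset_carrier[OF assms] that]
        by (simp add: monomial_ideal_def)
      show "p \<oplus>\<^bsub>?R\<^esub> q \<in> ?I" if "p \<in> ?I" "q \<in> ?I" for p q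
        using that keys_add[of p q] by (auto simp: monomial_ideal_def mpoly_ring_simps)
    qed
    show "x \<otimes>\<^bsub>?R\<^esub> p \<in> ?I" if "p \<in> ?I" "x \<in> carrier ?R" for p x
      using times_in_monomial_ideal[OF assms that] by (simp only: mpoly_ring_simps)
    show "p \<otimes>\<^bsub>?R\<^esub> x \<in> ?I" if "p \<in> ?I" "x \<in> carrier ?R" for p x
      using times_in_monomial_ideal[OF assms that] by (simp only: mpoly_ring_simps mult.commute)
  qed
qed

lemma genideal_monomials:
  assumes "up_closed n A"
  shows "genideal (mpoly_ring n) {Poly_Mapping.single a 1 | a. a \<in> A}
    = (monomial_ideal A :: 'a::field mpoly set)"
proof -
  let ?R = "mpoly_ring n :: 'a mpoly ring"
  let ?S = "{Poly_Mapping.single a (1::'a) | a. a \<in> A}"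
  interpret R: cring ?R by (rule cring_mpoly_ring)
  have S: "?S \<subseteq> monomial_ideal A" by (auto intro: single_in_monomial_ideal)
  then have "?S \<subseteq> carrier ?R" using monomial_ideal_subset_carrier[OF assms] by blast
  then interpret J: ideal "genideal ?R ?S" ?R by (rule R.genideal_ideal)
  have "p \<in> genideal ?R ?S" if "p \<in> monomial_ideal A" for p
    using that
  proof (induction p rule: monomial_ideal_induct)
    case zero
    show ?case using J.zero_closed by (simp add: mpoly_ring_simps)
  next
    case (single a c)
    then have "Poly_Mapping.single a 1 \<in> genideal ?R ?S"
      using R.genideal_self[OF \<open>?S \<subseteq> carrier ?R\<close>] by blast
    then show ?case
      using J.I_l_closed[of "Poly_Mapping.single a 1" "Poly_Mapping.single 0 c"]
      by (simp add: mpoly_ring_simps mult_single)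
  next
    case (add p q)
    then show ?case using J.a_closed by (simp add: mpoly_ring_simps)
  qed
  moreover have "genideal ?R ?S \<subseteq> monomial_ideal A"
    by (rule R.genideal_minimal[OF ideal_monomial_ideal[OF assms] S])
  ultimately show ?thesis by blast
qed

text \<open>
  A term with exponent \<open>a + b\<close> is a term with exponent \<open>a\<close> times the monomial with exponent \<open>b\<close>, so powers of a
  monomial ideal can be computed on exponent vectors alone.
\<close>

lemma ideal_prod_monomial_ideal:
  "ideal_prod (mpoly_ring n) (monomial_ideal A) (monomial_ideal B)
    = (monomial_ideal {a + b | a b. a \<in> A \<and> b \<in> B} :: 'a::field mpoly set)"
    (is "?L = monomial_ideal ?C")
proof (intro equalityI subsetI)
  fix p :: "'a mpoly" assume "p \<in> ?L"
  then show "p \<in> monomial_ideal ?C"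
  proof (induction rule: ideal_prod.induct)
    case (prod f g)
    then show ?case using keys_mult[of f g]
      by (fastforce simp: monomial_ideal_def mpoly_ring_simps)
  next
    case (sum f g)
    then show ?case using keys_add[of f g]
      by (fastforce simp: monomial_ideal_def mpoly_ring_simps)
  qed
next
  fix p :: "'a mpoly" assume "p \<in> monomial_ideal ?C"
  then show "p \<in> ?L"
  proof (induction p rule: monomial_ideal_induct)
    case zero
    show ?case
      using ideal_prod.prod[of 0 "monomial_ideal A" 0 "monomial_ideal B" "mpoly_ring n"]
      by (simp add: monomial_ideal_def mpoly_ring_simps)
  next
    case (single e c)
    then obtain a b where ab: "e = a + b" "a \<in> A" "b \<in> B" by blast
    then show ?case
      using ideal_prod.prod[OF single_in_monomial_ideal single_in_monomial_ideal, of a A b B "mpoly_ring n" c 1]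
      by (simp add: mpoly_ring_simps mult_single)
  next
    case (add p q)
    then show ?case using ideal_prod.sum[of p "mpoly_ring n"] by (simp add: mpoly_ring_simps)
  qed
qed

lemma ideals_set_simps:
  "\<one>\<^bsub>ideals_set R\<^esub> = carrier R" "I \<otimes>\<^bsub>ideals_set R\<^esub> J = ideal_prod R I J"
  by (simp_all add: ideals_set_def)

lemma lookup_times_monomial:
  "Poly_Mapping.lookup ((p :: 'a::field mpoly) * Poly_Mapping.single b 1) (a + b)
    = Poly_Mapping.lookup p a"
  by (induction p rule: mpoly_single_add_induct)
    (simp_all add: mult_single lookup_single lookup_add distrib_right when_def)

lemma times_monomial_in_monomial_ideal:
  assumes "p * Poly_Mapping.single b 1 \<in> monomial_ideal A" "a \<in> Poly_Mapping.keys p"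
  shows "a + b \<in> A"
proof -
  have "a + b \<in> Poly_Mapping.keys (p * Poly_Mapping.single b 1)"
    using assms(2) by (simp add: in_keys_iff lookup_times_monomial)
  then show ?thesis using assms(1) by (auto simp: monomial_ideal_def)
qed

lemma nonzerodivisor_monomial:
  assumes "Poly_Mapping.keys a \<subseteq> {..n}"
  shows "nonzerodivisor (mpoly_ring n) (Poly_Mapping.single a 1 :: 'a::field mpoly)"
proof -
  have "Poly_Mapping.single a (1::'a) \<noteq> 0"
    by (metis lookup_single_eq lookup_zero zero_neq_one)
  then show ?thesis using assms by (auto simp: nonzerodivisor_def mpoly_ring_simps)
qed

section \<open>The exponents of the powers of the initial ideal\<close>

definition deg_on :: "nat set \<Rightarrow> (nat \<Rightarrow>\<^sub>0 nat) \<Rightarrow> nat" where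
  "deg_on S a = (\<Sum>i \<in> S. Poly_Mapping.lookup a i)"

text \<open>
  The exponents of the \<open>l\<close>-th power of the ideal generated by the \<open>x\<^sub>s x\<^sub>t\<close> (\<open>1 \<le> s \<le> t < n\<close>), the
  \<open>x\<^sub>s x\<^sub>n\<^sup>q\<close> (\<open>r \<le> s < n\<close>) and \<open>x\<^sub>n\<^bsup>q+1\<^esup>\<close>: here \<open>i\<close>, \<open>j\<close> and \<open>k\<close> count the factors of these three
  kinds. After \<open>j\<close> of the variables \<open>x\<^sub>r, \<dots>, x\<^bsub>n-1\<^esub>\<close> have been used, any \<open>2 i\<close> of the remaining
  middle variables make up the factors of the first kind, so only degrees matter.
\<close>

definition pow_exps :: "nat \<Rightarrow> nat \<Rightarrow> nat \<Rightarrow> nat \<Rightarrow> (nat \<Rightarrow>\<^sub>0 nat) set" where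
  "pow_exps n q r l = {a. Poly_Mapping.keys a \<subseteq> {..n} \<and>
     (\<exists>i j k. i + j + k = l \<and> j \<le> deg_on {r..<n} a \<and> 2 * i + j \<le> deg_on {1..<n} a \<and>
        q * j + (q + 1) * k \<le> Poly_Mapping.lookup a n)}"

lemma pow_expsI:
  assumes "Poly_Mapping.keys a \<subseteq> {..n}" "i + j + k = l" "j \<le> deg_on {r..<n} a"
    "2 * i + j \<le> deg_on {1..<n} a" "q * j + (q + 1) * k \<le> Poly_Mapping.lookup a n"
  shows "a \<in> pow_exps n q r l"
  using assms unfolding pow_exps_def by blast

lemma pow_expsE:
  assumes "a \<in> pow_exps n q r l"
  obtains i j k where "Poly_Mapping.keys a \<subseteq> {..n}" "i + j + k = l" "j \<le> deg_on {r..<n} a"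
    "2 * i + j \<le> deg_on {1..<n} a" "q * j + (q + 1) * k \<le> Poly_Mapping.lookup a n"
  using assms unfolding pow_exps_def by blast

lemma deg_on_add: "deg_on S (a + b) = deg_on S a + deg_on S b"
  by (simp add: deg_on_def lookup_add sum.distrib)

lemma deg_on_single: "finite S \<Longrightarrow> deg_on S (Poly_Mapping.single i e) = (if i \<in> S then e else 0)"
  by (simp add: deg_on_def lookup_single when_def)

lemma split_single:
  assumes "e \<le> Poly_Mapping.lookup a i"
  obtains b where "a = b + Poly_Mapping.single i (e::nat)"
proof
  show "a = (a - Poly_Mapping.single i e) + Poly_Mapping.single i e"
    using assms by (intro poly_mapping_eqI)
      (auto simp: lookup_add lookup_minus lookup_single when_def)
qed

lemma split_variable:
  assumes "deg_on S a \<noteq> 0"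
  obtains i b where "i \<in> S" "a = b + Poly_Mapping.single i 1"
proof -
  from assms obtain i where "i \<in> S" "Poly_Mapping.lookup a i \<noteq> 0"
    unfolding deg_on_def by (meson sum.not_neutral_contains_not_neutral)
  then show ?thesis using split_single[of 1 a i] that by (metis less_one linorder_not_less)
qed

lemma pow_exps_0: "pow_exps n q r 0 = {a. Poly_Mapping.keys a \<subseteq> {..n}}"
  by (simp add: pow_exps_def)

lemma up_closed_pow_exps: "up_closed n (pow_exps n q r l)"
  unfolding up_closed_def
proof (intro conjI ballI allI impI)
  fix a b :: "nat \<Rightarrow>\<^sub>0 nat" assume "a \<in> pow_exps n q r l" and b: "Poly_Mapping.keys b \<subseteq> {..n}"
  then show "a + b \<in> pow_exps n q r l"
  proof (elim pow_expsE)
    fix i j k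
    assume "Poly_Mapping.keys a \<subseteq> {..n}" "i + j + k = l" "j \<le> deg_on {r..<n} a"
      "2 * i + j \<le> deg_on {1..<n} a" "q * j + (q + 1) * k \<le> Poly_Mapping.lookup a n"
    with b show ?thesis
      by (intro pow_expsI[of _ _ i j k]) (auto simp: keys_add_exponents deg_on_add lookup_add)
  qed
qed (simp add: pow_exps_def)

lemma pow_exps_add:
  assumes "a \<in> pow_exps n q r l" "b \<in> pow_exps n q r l'"
  shows "a + b \<in> pow_exps n q r (l + l')"
  using assms(1)
proof (rule pow_expsE)
  fix i j k
  assume a: "Poly_Mapping.keys a \<subseteq> {..n}" "i + j + k = l" "j \<le> deg_on {r..<n} a"
    "2 * i + j \<le> deg_on {1..<n} a" "q * j + (q + 1) * k \<le> Poly_Mapping.lookup a n"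
  show ?thesis
    using assms(2)
  proof (rule pow_expsE)
    fix i' j' k'
    assume b: "Poly_Mapping.keys b \<subseteq> {..n}" "i' + j' + k' = l'" "j' \<le> deg_on {r..<n} b"
      "2 * i' + j' \<le> deg_on {1..<n} b" "q * j' + (q + 1) * k' \<le> Poly_Mapping.lookup b n"
    show ?thesis
      using a b by (intro pow_expsI[of _ _ "i + i'" "j + j'" "k + k'"])
        (auto simp: keys_add_exponents deg_on_add lookup_add algebra_simps)
  qed
qed

lemma pair_in_pow_exps_1:
  assumes "i \<in> {1..<n}" "j \<in> {1..<n}"
  shows "Poly_Mapping.single i 1 + Poly_Mapping.single j 1 \<in> pow_exps n q r 1"
  using assms
  by (intro pow_expsI[of _ _ 1 0 0])
    (auto simp: keys_add_exponents deg_on_add deg_on_single lookup_add lookup_single)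

lemma edge_in_pow_exps_1:
  assumes "i \<in> {r..n}" "0 < r"
  shows "Poly_Mapping.single i 1 + Poly_Mapping.single n q \<in> pow_exps n q r 1"
proof (cases "i = n")
  case True
  then show ?thesis
    by (intro pow_expsI[of _ _ 0 0 1])
      (auto simp: keys_add_exponents deg_on_add deg_on_single lookup_add lookup_single)
next
  case False
  then show ?thesis using assms
    by (intro pow_expsI[of _ _ 0 1 0])
      (auto simp: keys_add_exponents deg_on_add deg_on_single lookup_add lookup_single)
qed

text \<open>
  A factor \<open>x\<^sub>s x\<^sub>n\<^sup>q\<close> has to be split off before a factor \<open>x\<^sub>s x\<^sub>t\<close>: the latter may use up variables
  from \<open>x\<^sub>r, \<dots>, x\<^bsub>n-1\<^esub>\<close>, which is harmless only when \<open>j = 0\<close>. The \<open>edge\<close> case with \<open>s = n\<close> is the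
  generator \<open>x\<^sub>n\<^bsup>q+1\<^esup>\<close>.
\<close>

lemma pow_exps_Suc_cases:
  assumes "a \<in> pow_exps n q r (Suc l)" and r: "0 < r" "r \<le> n"
  obtains (pair) b i j where "b \<in> pow_exps n q r l" "i \<in> {1..<n}" "j \<in> {1..<n}"
      "a = b + (Poly_Mapping.single i 1 + Poly_Mapping.single j 1)"
    | (edge) b i where "b \<in> pow_exps n q r l" "i \<in> {r..n}"
      "a = b + (Poly_Mapping.single i 1 + Poly_Mapping.single n q)"
  using assms(1)
proof (rule pow_expsE)
  fix i j k
  assume a: "Poly_Mapping.keys a \<subseteq> {..n}" "i + j + k = Suc l" "j \<le> deg_on {r..<n} a"
    "2 * i + j \<le> deg_on {1..<n} a" "q * j + (q + 1) * k \<le> Poly_Mapping.lookup a n"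
  consider "j \<noteq> 0" | "j = 0" "k \<noteq> 0" | "j = 0" "k = 0" by blast
  then show thesis
  proof cases
    case 1
    then have "deg_on {r..<n} a \<noteq> 0" using a(3) by simp
    then obtain s b where s: "s \<in> {r..<n}" "a = b + Poly_Mapping.single s 1"
      by (rule split_variable)
    obtain j' where j': "j = Suc j'" using 1 by (cases j) auto
    have "q \<le> Poly_Mapping.lookup b n"
      using a(5) s by (simp add: j' lookup_add lookup_single)
    then obtain c where c: "b = c + Poly_Mapping.single n q" by (rule split_single)
    have "c \<in> pow_exps n q r l"
      by (rule pow_expsI[of _ _ i j' k]) (use a s c j' r in
        \<open>auto simp: keys_add_exponents deg_on_add deg_on_single lookup_add lookup_single\<close>)
    then show thesis using edge[of c s] s c by (auto simp: ac_simps)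
  next
    case 2
    then obtain k' where k': "k = Suc k'" by (cases k) auto
    have "q + 1 \<le> Poly_Mapping.lookup a n" using a(5) by (simp add: k')
    then obtain c where c: "a = c + Poly_Mapping.single n (q + 1)" by (rule split_single)
    have "c \<in> pow_exps n q r l"
      by (rule pow_expsI[of _ _ i 0 k']) (use a c k' 2 r in
        \<open>auto simp: keys_add_exponents deg_on_add deg_on_single lookup_add lookup_single\<close>)
    moreover have "n \<in> {r..n}" using r by simp
    ultimately show thesis using edge[of c n] c
      by (simp add: single_add[symmetric] add.commute)
  next
    case 3
    then have i: "i = Suc l" using a(2) by simp
    have "deg_on {1..<n} a \<noteq> 0" using a(4) i by simp
    then obtain s b where s: "s \<in> {1..<n}" "a = b + Poly_Mapping.single s 1"
      by (rule split_variable)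
    have "deg_on {1..<n} b \<noteq> 0" using a(4) i s by (simp add: deg_on_add deg_on_single)
    then obtain t c where t: "t \<in> {1..<n}" "b = c + Poly_Mapping.single t 1"
      by (rule split_variable)
    have "c \<in> pow_exps n q r l"
      by (rule pow_expsI[of _ _ l 0 0]) (use a s t i in
        \<open>auto simp: keys_add_exponents deg_on_add deg_on_single lookup_add lookup_single\<close>)
    then show thesis using pair[of c t s] s t by (auto simp: ac_simps)
  qed
qed

lemma pow_exps_plus:
  assumes r: "0 < r" "r \<le> n"
  shows "{a + b | a b. a \<in> pow_exps n q r l \<and> b \<in> pow_exps n q r l'} = pow_exps n q r (l + l')"
    (is "?S l' = _")
proof
  show "?S l' \<subseteq> pow_exps n q r (l + l')" by (auto intro: pow_exps_add)
  show "pow_exps n q r (l + l') \<subseteq> ?S l'"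
  proof (induction l')
    case 0
    have "(0 :: nat \<Rightarrow>\<^sub>0 nat) \<in> pow_exps n q r 0" by (simp add: pow_exps_0)
    then show ?case by (metis (mono_tags, lifting) CollectI add_0_right subsetI)
  next
    case (Suc l')
    show ?case
    proof
      fix a assume "a \<in> pow_exps n q r (l + Suc l')"
      then have "a \<in> pow_exps n q r (Suc (l + l'))" by simp
      then obtain b g where b: "b \<in> pow_exps n q r (l + l')" "g \<in> pow_exps n q r 1" "a = b + g"
        using r
      proof (cases rule: pow_exps_Suc_cases)
        case (pair b i j)
        then show ?thesis using that pair_in_pow_exps_1 by blast
      next
        case (edge b i)
        then show ?thesis using that edge_in_pow_exps_1 r(1) by blast
      qed
      with Suc obtain u v where "b = u + v" "u \<in> pow_exps n q r l" "v \<in> pow_exps n q r l'" by blast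
      then show "a \<in> ?S (Suc l')"
        using b pow_exps_add[of v n q r l' g 1] by (force simp: add.assoc)
    qed
  qed
qed

section \<open>The Ratliff-Rush property\<close>

text \<open>
  The inclusion \<open>I\<^bsup>l+1\<^esup> : x\<^sub>n\<^bsup>q+1\<^esup> \<subseteq> I\<^sup>l\<close> on exponents. A factor \<open>x\<^sub>n\<^bsup>q+1\<^esup>\<close> of the product, if there is one, is
  dropped. Otherwise the product has \<open>j\<close> factors \<open>x\<^sub>s x\<^sub>n\<^sup>q\<close>, and dropping one of them may
  leave \<open>x\<^sub>n\<close> one short, so two are traded for a single \<open>x\<^sub>s x\<^sub>t\<close>, which lowers the demand on \<open>x\<^sub>n\<close>
  by \<open>2 q \<ge> q + 1\<close>.
\<close>

lemma pow_exps_cancel: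
  assumes "a + Poly_Mapping.single n (q + 1) \<in> pow_exps n q r (Suc l)" "0 < q"
    and a: "Poly_Mapping.keys a \<subseteq> {..n}"
  shows "a \<in> pow_exps n q r l"
  using assms(1)
proof (rule pow_expsE)
  fix i j k
  assume *: "i + j + k = Suc l" "j \<le> deg_on {r..<n} (a + Poly_Mapping.single n (q + 1))"
    "2 * i + j \<le> deg_on {1..<n} (a + Poly_Mapping.single n (q + 1))"
    "q * j + (q + 1) * k \<le> Poly_Mapping.lookup (a + Poly_Mapping.single n (q + 1)) n"
  then have **: "j \<le> deg_on {r..<n} a" "2 * i + j \<le> deg_on {1..<n} a"
    "q * j + (q + 1) * k \<le> Poly_Mapping.lookup a n + (q + 1)"
    by (simp_all add: deg_on_add deg_on_single lookup_add lookup_single)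
  consider k' where "k = Suc k'" | "k = 0" "j = 0" | "k = 0" "j = 1"
    | j' where "k = 0" "j = Suc (Suc j')"
    by (metis One_nat_def not0_implies_Suc)
  then show ?thesis
  proof cases
    case 1
    then show ?thesis using * ** a by (intro pow_expsI[of _ _ i j k']) auto
  next
    case 2
    then show ?thesis using * ** a by (intro pow_expsI[of _ _ l 0 0]) auto
  next
    case 3
    then show ?thesis using * ** a by (intro pow_expsI[of _ _ i 0 0]) auto
  next
    case 4
    then show ?thesis using * ** a assms(2) by (intro pow_expsI[of _ _ "Suc i" j' 0]) auto
  qed
qed

lemma pow_exps_cancel_power:
  assumes "a + Poly_Mapping.single n ((q + 1) * k) \<in> pow_exps n q r (l + k)" "0 < q"
    and a: "Poly_Mapping.keys a \<subseteq> {..n}"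
  shows "a \<in> pow_exps n q r l"
  using assms(1)
proof (induction k)
  case 0
  then show ?case by simp
next
  case (Suc k)
  have "Poly_Mapping.single n ((q + 1) * Suc k)
      = Poly_Mapping.single n ((q + 1) * k) + Poly_Mapping.single n (q + 1)"
    by (simp only: single_add[symmetric] mult_Suc_right add.commute)
  with Suc.prems have "a + Poly_Mapping.single n ((q + 1) * k) + Poly_Mapping.single n (q + 1)
      \<in> pow_exps n q r (Suc (l + k))"
    by (simp only: add.assoc add_Suc_right)
  then have "a + Poly_Mapping.single n ((q + 1) * k) \<in> pow_exps n q r (l + k)"
    by (rule pow_exps_cancel) (use assms in \<open>auto simp: keys_add_exponents\<close>)
  then show ?case by (rule Suc.IH)
qed

lemma single_last_in_pow_exps: "Poly_Mapping.single n ((q + 1) * k) \<in> pow_exps n q r k"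
  by (rule pow_expsI[of _ _ 0 0 k]) auto

lemma ideal_pow_monomial_ideal_pow_exps:
  assumes "0 < r" "r \<le> n"
  shows "ideal_pow (mpoly_ring n) (monomial_ideal (pow_exps n q r l)) k
    = (monomial_ideal (pow_exps n q r (l * k)) :: 'a::field mpoly set)"
proof (induction k)
  case 0
  show ?case by (simp add: ideals_set_simps pow_exps_0 monomial_ideal_exponents)
next
  case (Suc k)
  then show ?case
    using pow_exps_plus[OF assms, of q "l * k" l]
    by (simp add: ideals_set_simps ideal_prod_monomial_ideal add.commute)
qed

text \<open>
  Multiplication by the monomial \<open>x\<^sub>n\<^bsup>(q+1)lk\<^esup>\<close> of the \<open>k\<close>-th power shifts the exponents of \<open>z\<close> without
  cancellation, so each of them can be treated separately.
\<close>

lemma ratliff_rush_pow_exps: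
  assumes "0 < r" "r \<le> n" "0 < q"
  shows "ratliff_rush (mpoly_ring n) (monomial_ideal (pow_exps n q r l) :: 'a::field mpoly set)"
proof -
  let ?R = "mpoly_ring n :: 'a mpoly ring"
  let ?I = "monomial_ideal (pow_exps n q r l) :: 'a mpoly set"
  let ?y = "\<lambda>k. Poly_Mapping.single (Poly_Mapping.single n ((q + 1) * k)) (1 :: 'a)"
  note pow = ideal_pow_monomial_ideal_pow_exps[OF assms(1,2), of q l]
  interpret I: ideal ?I ?R by (rule ideal_monomial_ideal[OF up_closed_pow_exps])
  have y: "?y k \<in> monomial_ideal (pow_exps n q r k)" for k
    by (rule single_in_monomial_ideal[OF single_last_in_pow_exps])
  have "z \<in> ?I" if "z \<in> colon ?R (ideal_pow ?R ?I (k + 1)) (ideal_pow ?R ?I k)" for z k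
  proof -
    have z: "z \<in> carrier ?R" "z * ?y (l * k) \<in> monomial_ideal (pow_exps n q r (l + l * k))"
      using that y[of "l * k"]
      by (auto simp: colon_def pow mpoly_ring_simps simp del: nat_pow_Suc)
    show ?thesis unfolding monomial_ideal_def
    proof (rule CollectI, rule subsetI)
      fix a assume a: "a \<in> Poly_Mapping.keys z"
      show "a \<in> pow_exps n q r l"
        using times_monomial_in_monomial_ideal[OF z(2) a] assms(3)
        by (rule pow_exps_cancel_power) (use a z in \<open>auto simp: mpoly_ring_simps\<close>)
    qed
  qed
  moreover have "z \<in> colon ?R (ideal_pow ?R ?I (1 + 1)) (ideal_pow ?R ?I 1)" if "z \<in> ?I" for z
  proof -
    have "ideal_pow ?R ?I (1 + 1) = ideal_prod ?R ?I ?I"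
      using pow_exps_plus[OF assms(1,2), of q l l]
      unfolding pow ideal_prod_monomial_ideal by (simp add: mult_2_right)
    moreover have "ideal_pow ?R ?I 1 = ?I" by (simp only: pow mult_1_right)
    ultimately show ?thesis
      using that I.Icarr ideal_prod.prod[OF that, of _ ?I ?R] by (simp only: colon_def) blast
  qed
  ultimately have "?I = ratliff_rush_closure ?R ?I"
    unfolding ratliff_rush_closure_def by (intro equalityI subsetI) (blast, blast)
  moreover have "nonzerodivisor ?R (?y l)" by (rule nonzerodivisor_monomial) simp
  ultimately show ?thesis
    unfolding ratliff_rush_def regular_ideal_def using y I.ideal_axioms by blast
qed

section \<open>The initial ideal\<close>

lemma grevlex_less_add_left:
  assumes "grevlex_less m a b"
  shows "grevlex_less m (c + a) (c + b)"
  using assms unfolding grevlex_less_def by (simp add: wdeg_add lookup_add)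

lemma grevlex_less_asym: "grevlex_less m a b \<Longrightarrow> \<not> grevlex_less m b a"
  using grevlex_less_trans[of m a b a] grevlex_less_irrefl[of m a] by blast

lemma wdeg_single: "wdeg m (Poly_Mapping.single i e) = e * m i"
  by (simp add: wdeg_def)

text \<open>Finiteness is what makes repeated reduction within one weight terminate.\<close>

lemma finite_exponents_of_wdeg:
  assumes "\<And>i. i \<le> n \<Longrightarrow> 0 < m i"
  shows "finite {a. Poly_Mapping.keys a \<subseteq> {..n} \<and> wdeg m a = w}" (is "finite ?S")
proof -
  have "Poly_Mapping.lookup a i \<le> w" if "a \<in> ?S" "i \<le> n" for a i
  proof (cases "i \<in> Poly_Mapping.keys a")
    case True
    have "Poly_Mapping.lookup a i \<le> Poly_Mapping.lookup a i * m i"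
      using assms[OF that(2)] by simp
    also have "\<dots> \<le> wdeg m a"
      unfolding wdeg_def using True by (intro member_le_sum) auto
    finally show ?thesis using that by simp
  qed (simp add: in_keys_iff)
  then have "Poly_Mapping.lookup ` ?S
      \<subseteq> {f. \<forall>i. (i \<in> {..n} \<longrightarrow> f i \<in> {..w}) \<and> (i \<notin> {..n} \<longrightarrow> f i = 0)}"
    by (auto simp: in_keys_iff subset_iff)
  then have "finite (Poly_Mapping.lookup ` ?S)"
    by (rule finite_subset) (intro finite_set_of_finite_funs finite_atMost)
  then show ?thesis
    by (rule finite_imageD) (simp add: inj_on_def poly_mapping_eqI)
qed

locale arithmetic_sequence =
  fixes n m0 d q r :: nat and m :: "nat \<Rightarrow> nat"
  assumes r: "0 < r" "r \<le> n"
    and q: "0 < q"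
    and m0_eq: "m0 = q * n + r"
    and m_eq: "i \<le> n \<Longrightarrow> m i = m0 + i * d"
    and coprime_m0_d: "coprime m0 d"
begin

text \<open>
  The left-most index at which the two exponents differ is \<open>i - 1\<close>, and the larger monomial
  \<open>x\<^sub>i x\<^sub>j\<close> has exponent \<open>0\<close> there. The order of \<open>i\<close> and \<open>j\<close> matters: for \<open>j < i - 1\<close> the
  reduction would make the monomial larger.
\<close>

lemma reduce_pair:
  assumes "1 \<le> i" "i \<le> j" "j < n"
  defines "a \<equiv> Poly_Mapping.single i 1 + Poly_Mapping.single j 1"
    and "b \<equiv> Poly_Mapping.single (i - 1) 1 + Poly_Mapping.single (j + 1) (1 :: nat)"
  shows "wdeg m b = wdeg m a" "grevlex_less m b a" "Poly_Mapping.keys b \<subseteq> {..n}"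
proof -
  obtain i' where i': "i = Suc i'" using assms(1) by (cases i) auto
  show wdeg: "wdeg m b = wdeg m a"
    using assms(1-3) by (simp add: a_def b_def wdeg_add wdeg_single m_eq i' algebra_simps)
  show "grevlex_less m b a"
    unfolding grevlex_less_def using assms(1-3) wdeg
    by (intro disjI2 conjI exI[of _ i']) (auto simp: a_def b_def lookup_add lookup_single i')
  show "Poly_Mapping.keys b \<subseteq> {..n}" using assms(1-3) by (auto simp: b_def keys_add_exponents)
qed

text \<open>
  The weights agree because \<open>q n d + r d = m0 d\<close>, and the exponents already differ at index \<open>0\<close>.
\<close>

lemma reduce_edge:
  assumes "r \<le> i" "i \<le> n"
  defines "a \<equiv> Poly_Mapping.single i 1 + Poly_Mapping.single n q"
    and "b \<equiv> Poly_Mapping.single (i - r) 1 + Poly_Mapping.single 0 (q + d)"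
  shows "wdeg m b = wdeg m a" "grevlex_less m b a" "Poly_Mapping.keys b \<subseteq> {..n}"
proof -
  obtain k where k: "i = k + r" using assms(1) by (metis le_add_diff_inverse2)
  have "wdeg m b = m0 + k * d + (q + d) * m0"
    using assms(2) k by (simp add: b_def wdeg_add wdeg_single m_eq)
  also have "\<dots> = m0 + (k + r) * d + q * (m0 + n * d)"
    by (simp add: m0_eq algebra_simps)
  also have "\<dots> = wdeg m a"
    using assms(2) k by (simp add: a_def wdeg_add wdeg_single m_eq)
  finally show wdeg: "wdeg m b = wdeg m a" .
  show "grevlex_less m b a"
    unfolding grevlex_less_def using r q k wdeg
    by (intro disjI2 conjI exI[of _ 0]) (auto simp: a_def b_def lookup_add lookup_single)
  show "Poly_Mapping.keys b \<subseteq> {..n}" using assms(1,2) by (auto simp: b_def keys_add_exponents)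
qed

lemma reduce:
  assumes "a \<in> pow_exps n q r 1"
  obtains b where "Poly_Mapping.keys b \<subseteq> {..n}" "wdeg m b = wdeg m a" "grevlex_less m b a"
proof -
  have "a \<in> pow_exps n q r (Suc 0)" using assms by simp
  then show thesis
    using r
  proof (cases rule: pow_exps_Suc_cases)
    case (pair c i j)
    define i' where "i' = min i j"
    define j' where "j' = max i j"
    have ij: "1 \<le> i'" "i' \<le> j'" "j' < n" using pair by (auto simp: i'_def j'_def)
    have a: "a = c + (Poly_Mapping.single i' 1 + Poly_Mapping.single j' 1)"
      using pair by (auto simp: i'_def j'_def min_def max_def add.commute)
    show thesis
      using that[of "c + (Poly_Mapping.single (i' - 1) 1 + Poly_Mapping.single (j' + 1) 1)"]
        reduce_pair[OF ij] grevlex_less_add_left[of m _ _ c] pair(1)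
      unfolding a by (simp add: pow_exps_0 keys_add_exponents wdeg_add)
  next
    case (edge c i)
    then have i: "r \<le> i" "i \<le> n" by auto
    show thesis
      using that[of "c + (Poly_Mapping.single (i - r) 1 + Poly_Mapping.single 0 (q + d))"]
        reduce_edge[OF i] grevlex_less_add_left[of m _ _ c] edge(1)
      unfolding edge(3) by (simp add: pow_exps_0 keys_add_exponents wdeg_add)
  qed
qed

text \<open>
  A standard monomial, that is, one outside the ideal, contains at most one middle variable \<open>x\<^sub>j\<close>,
  since it is not divisible by any \<open>x\<^sub>s x\<^sub>t\<close>, and the other generators bound \<open>s\<close>: either \<open>s < q\<close>, or \<open>s = q\<close> and \<open>j < r\<close>. In both
  cases this yields \<open>j + n s < q n + r\<close>.
\<close>

lemma standard_normal_form:
  assumes c: "Poly_Mapping.keys c \<subseteq> {..n}" "c \<notin> pow_exps n q r 1"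
  obtains e j s where "j < n" "j + n * s < m0"
    "c = Poly_Mapping.single 0 e + (if j = 0 then 0 else Poly_Mapping.single j 1)
      + Poly_Mapping.single n s"
proof -
  have n: "0 < n" using r by simp
  define e where "e = Poly_Mapping.lookup c 0"
  define s where "s = Poly_Mapping.lookup c n"
  \<comment> \<open>The part \<open>v\<close> of \<open>c\<close> in the middle variables is isolated first.\<close>
  obtain u where u: "c = u + Poly_Mapping.single 0 e"
    unfolding e_def by (rule split_single[OF order.refl])
  have "s \<le> Poly_Mapping.lookup u n"
    using n by (simp add: s_def u lookup_add lookup_single)
  then obtain v where "u = v + Poly_Mapping.single n s" by (rule split_single)
  then have cv: "c = Poly_Mapping.single 0 e + v + Poly_Mapping.single n s"
    using u by (simp add: ac_simps)
  have v: "Poly_Mapping.keys v \<subseteq> {..n}" "Poly_Mapping.lookup v 0 = 0" "Poly_Mapping.lookup v n = 0"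
  proof -
    show "Poly_Mapping.keys v \<subseteq> {..n}" using c(1) by (simp add: cv keys_add_exponents)
    have "e = e + Poly_Mapping.lookup v 0"
      using n by (subst e_def) (simp add: cv lookup_add lookup_single)
    then show "Poly_Mapping.lookup v 0 = 0" by simp
    have "s = Poly_Mapping.lookup v n + s"
      using n by (subst s_def) (simp add: cv lookup_add lookup_single)
    then show "Poly_Mapping.lookup v n = 0" by simp
  qed
  have zero: "w = 0" if "Poly_Mapping.keys w \<subseteq> {..n}" "Poly_Mapping.lookup w 0 = 0"
    "Poly_Mapping.lookup w n = 0" "deg_on {1..<n} w = 0" for w
  proof (rule poly_mapping_eqI)
    fix i
    consider "i = 0" | "i \<in> {1..<n}" | "i = n" | "i \<notin> {..n}" by fastforce
    then show "Poly_Mapping.lookup w i = Poly_Mapping.lookup 0 i"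
      using that by cases (auto simp: deg_on_def in_keys_iff subset_iff)
  qed
  have s: "s \<le> q"
  proof (rule ccontr)
    assume "\<not> s \<le> q"
    then have "c \<in> pow_exps n q r 1"
      using c(1) by (intro pow_expsI[of _ _ 0 0 1]) (auto simp: s_def)
    with c(2) show False by simp
  qed
  show thesis
  proof (cases "deg_on {1..<n} v = 0")
    case True
    have "n * s < m0"
      using mult_le_mono2[OF s, of n] r unfolding m0_eq mult.commute[of q n] by linarith
    then show thesis using that[of 0 s e] cv zero[OF v True] r by simp
  next
    case False
    then obtain j w where j: "j \<in> {1..<n}" and w: "v = w + Poly_Mapping.single j 1"
      by (rule split_variable)
    have "deg_on {1..<n} w = 0"
    proof (rule ccontr)
      assume "deg_on {1..<n} w \<noteq> 0"
      then have "2 \<le> deg_on {1..<n} c"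
        using j by (simp add: cv w deg_on_add deg_on_single)
      then have "c \<in> pow_exps n q r 1"
        using c(1) by (intro pow_expsI[of _ _ 1 0 0]) auto
      with c(2) show False by simp
    qed
    then have "w = 0"
      using v j by (intro zero) (auto simp: w keys_add_exponents lookup_add)
    have "j < r" if "s = q"
    proof (rule ccontr)
      assume "\<not> j < r"
      then have "1 \<le> deg_on {r..<n} c" "1 \<le> deg_on {1..<n} c"
        using j by (simp_all add: cv w deg_on_add deg_on_single)
      then have "c \<in> pow_exps n q r 1"
        using c(1) that by (intro pow_expsI[of _ _ 0 1 0]) (auto simp: s_def)
      with c(2) show False by simp
    qed
    then have "j + n * s < m0"
    proof (cases "s = q")
      case False
      then have "n * (s + 1) \<le> n * q" using s by (intro mult_le_mono) auto
      then show ?thesis using j r by (simp add: m0_eq mult.commute)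
    qed (simp add: m0_eq mult.commute)
    then show thesis
      using that[of j s e] j cv w \<open>w = 0\<close> by simp
  qed
qed

text \<open>
  The weight of \<open>x\<^sub>0\<^sup>e x\<^sub>j x\<^sub>n\<^sup>s\<close> modulo \<open>m0\<close> determines \<open>j + n s\<close>, which lies below \<open>m0\<close>. Division by \<open>n\<close>
  then recovers \<open>j\<close> and \<open>s\<close>, and the weight itself gives \<open>e\<close>.
\<close>

lemma standard_eqI:
  assumes a: "Poly_Mapping.keys a \<subseteq> {..n}" "a \<notin> pow_exps n q r 1"
    and b: "Poly_Mapping.keys b \<subseteq> {..n}" "b \<notin> pow_exps n q r 1"
    and "wdeg m a = wdeg m b"
  shows "a = b"
proof -
  define f where "f e j s = Poly_Mapping.single 0 e
    + (if j = 0 then 0 else Poly_Mapping.single j 1) + Poly_Mapping.single n s" for e j s :: nat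
  have wdeg_f: "wdeg m (f e j s) = (e + (if j = 0 then 0 else 1) + s) * m0 + (j + n * s) * d"
    if "j < n" for e j s
    using that by (simp add: f_def wdeg_add wdeg_single m_eq algebra_simps) (simp add: wdeg_def)
  obtain e j s where 1: "j < n" "j + n * s < m0" "a = f e j s"
    using standard_normal_form[OF a] unfolding f_def by metis
  obtain e' j' s' where 2: "j' < n" "j' + n * s' < m0" "b = f e' j' s'"
    using standard_normal_form[OF b] unfolding f_def by metis
  have eq: "(e + (if j = 0 then 0 else 1) + s) * m0 + (j + n * s) * d
      = (e' + (if j' = 0 then 0 else 1) + s') * m0 + (j' + n * s') * d"
    using assms(5) 1 2 wdeg_f by metis
  then have "[(j + n * s) * d = (j' + n * s') * d] (mod m0)"
    unfolding cong_def by (metis mod_mult_self3)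
  then have "[j + n * s = j' + n * s'] (mod m0)"
    using coprime_m0_d by (simp add: cong_mult_rcancel_nat coprime_commute)
  then have js: "j + n * s = j' + n * s'"
    using 1 2 by (simp add: cong_less_modulus_unique_nat)
  then have "(j + n * s) mod n = (j' + n * s') mod n" "(j + n * s) div n = (j' + n * s') div n"
    by simp_all
  then have "j = j'" "s = s'" using 1(1) 2(1) by simp_all
  moreover have "e = e'" using eq \<open>j = j'\<close> \<open>s = s'\<close> r by (simp add: m0_eq)
  ultimately show ?thesis using 1 2 by simp
qed

lemma standard_below:
  assumes "Poly_Mapping.keys a \<subseteq> {..n}"
  obtains c where "Poly_Mapping.keys c \<subseteq> {..n}" "c \<notin> pow_exps n q r 1" "wdeg m c = wdeg m a"
    "c = a \<or> grevlex_less m c a"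
proof -
  define S where "S = {c. Poly_Mapping.keys c \<subseteq> {..n} \<and> wdeg m c = wdeg m a
    \<and> (c = a \<or> grevlex_less m c a)}"
  have "finite {c. Poly_Mapping.keys c \<subseteq> {..n} \<and> wdeg m c = wdeg m a}"
    using r by (intro finite_exponents_of_wdeg) (simp add: m_eq m0_eq)
  then have "finite S" unfolding S_def by (rule finite_subset[rotated]) blast
  moreover have "asymp_on S (grevlex_less m)"
    by (rule asymp_onI) (rule grevlex_less_asym)
  moreover have "transp_on S (grevlex_less m)"
    by (rule transp_onI) (rule grevlex_less_trans)
  moreover have "S \<noteq> {}" using assms by (auto simp: S_def)
  ultimately have "\<exists>c \<in> S. \<forall>x \<in> S. x \<noteq> c \<longrightarrow> \<not> grevlex_less m x c"
    by (rule Finite_Set.bex_min_element)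
  then obtain c where c: "c \<in> S" "\<forall>x \<in> S. x \<noteq> c \<longrightarrow> \<not> grevlex_less m x c" ..
  have "c \<notin> pow_exps n q r 1"
  proof
    assume "c \<in> pow_exps n q r 1"
    then obtain b where b: "Poly_Mapping.keys b \<subseteq> {..n}" "wdeg m b = wdeg m c" "grevlex_less m b c"
      by (rule reduce)
    have "grevlex_less m b a"
      using c(1) b(3) grevlex_less_trans[of m b c a] by (auto simp: S_def)
    then have "b \<in> S" using c(1) b by (simp add: S_def)
    moreover have "b \<noteq> c" using b(3) grevlex_less_irrefl[of m c] by blast
    ultimately show False using b(3) c(2) by blast
  qed
  then show thesis using that[of c] c(1) by (simp add: S_def)
qed

text \<open>
  If \<open>a\<close> is the leading exponent of \<open>p \<in> P\<close>, its term must be cancelled in \<open>eta m p\<close> by that of some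
  other exponent \<open>b\<close> of \<open>p\<close> of the same weight, and \<open>b\<close> is smaller. The only standard exponent of
  this weight is at most \<open>b\<close>, hence different from \<open>a\<close>, so \<open>a\<close> is not standard. Conversely, a nonstandard \<open>a\<close> reduces to some \<open>b\<close>, and
  it leads the binomial with exponents \<open>a\<close> and \<open>b\<close>.
\<close>

lemma leading_exponents_eq:
  "{a. \<exists>p \<in> defining_ideal n m :: 'a::field mpoly set. p \<noteq> 0 \<and> is_leading_exponent m p a}
    = pow_exps n q r 1" (is "?L = _")
proof (intro equalityI subsetI)
  fix a assume "a \<in> ?L"
  then obtain p :: "'a mpoly" where "p \<in> defining_ideal n m" and a: "is_leading_exponent m p a"
    by blast
  then have p: "p \<in> carrier (mpoly_ring n)" "eta m p = 0"
    by (simp_all add: defining_ideal_def a_kernel_def' upoly_ring_def ring_on_def)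
  have ap: "a \<in> Poly_Mapping.keys p" using a by (simp add: is_leading_exponent_def)
  show "a \<in> pow_exps n q r 1"
  proof (rule ccontr)
    assume a_std: "a \<notin> pow_exps n q r 1"
    have "0 = (\<Sum>b \<in> Poly_Mapping.keys p. if wdeg m b = wdeg m a then Poly_Mapping.lookup p b else 0)"
      using arg_cong[OF p(2), of "\<lambda>f. coeff f (wdeg m a)"]
        eta_superset[of "Poly_Mapping.keys p" p m] by (simp add: coeff_sum)
    also have "\<dots> = Poly_Mapping.lookup p a + (\<Sum>b \<in> Poly_Mapping.keys p - {a}.
        if wdeg m b = wdeg m a then Poly_Mapping.lookup p b else 0)"
      using ap by (simp add: sum.remove)
    finally have "(\<Sum>b \<in> Poly_Mapping.keys p - {a}.
        if wdeg m b = wdeg m a then Poly_Mapping.lookup p b else 0) \<noteq> 0"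
      using ap by (auto simp: in_keys_iff)
    then obtain b where "b \<in> Poly_Mapping.keys p - {a}"
      "(if wdeg m b = wdeg m a then Poly_Mapping.lookup p b else 0) \<noteq> 0"
      by (rule sum.not_neutral_contains_not_neutral)
    then have b: "b \<in> Poly_Mapping.keys p" "b \<noteq> a" "wdeg m b = wdeg m a"
      by (auto split: if_splits)
    have less: "grevlex_less m b a" using a b by (simp add: is_leading_exponent_def)
    have keys: "Poly_Mapping.keys a \<subseteq> {..n}" "Poly_Mapping.keys b \<subseteq> {..n}"
      using p(1) ap b by (auto simp: mpoly_ring_simps)
    obtain c where c: "Poly_Mapping.keys c \<subseteq> {..n}" "c \<notin> pow_exps n q r 1" "wdeg m c = wdeg m b"
      "c = b \<or> grevlex_less m c b"
      using keys(2) by (rule standard_below)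
    then have "c = a" using standard_eqI[of c a] a_std keys b by simp
    then show False using c(4) b(2) less grevlex_less_asym[of m b a] by blast
  qed
next
  fix a assume a: "a \<in> pow_exps n q r 1"
  then obtain b where b: "Poly_Mapping.keys b \<subseteq> {..n}" "wdeg m b = wdeg m a" "grevlex_less m b a"
    by (rule reduce)
  then have "b \<noteq> a" using grevlex_less_irrefl[of m a] by blast
  define p where "p = Poly_Mapping.single a (1 :: 'a) + Poly_Mapping.single b (- 1)"
  have keys: "Poly_Mapping.keys p = {a, b}"
    using \<open>b \<noteq> a\<close> by (auto simp: p_def in_keys_iff lookup_add lookup_single when_def split: if_splits)
  have "eta m p = 0" by (simp add: p_def eta_add eta_single b(2) add_monom)
  moreover have "Poly_Mapping.keys a \<subseteq> {..n}" using a by (simp add: pow_exps_def)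
  ultimately have "p \<in> defining_ideal n m"
    using keys b(1)
    by (simp add: defining_ideal_def a_kernel_def' upoly_ring_def ring_on_def mpoly_ring_simps)
  moreover have "is_leading_exponent m p a" using keys b(3) by (simp add: is_leading_exponent_def)
  moreover have "p \<noteq> 0" using keys by auto
  ultimately show "a \<in> ?L" by blast
qed

lemma initial_ideal_eq:
  "initial_ideal n m (defining_ideal n m) = (monomial_ideal (pow_exps n q r 1) :: 'a::field mpoly set)"
  unfolding initial_ideal_def genideal_monomials[OF up_closed_pow_exps, symmetric]
  by (simp only: mem_Collect_eq flip: leading_exponents_eq[where 'a = 'a])

end

section \<open>Minimal generation\<close>

text \<open>
  If \<open>m0 \<le> n\<close>, then the index \<open>m0\<close> itself occurs in the sequence, and its entry
  \<open>m0 + m0 d = (1 + d) m0\<close> is a multiple of the first one.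
\<close>

lemma minimally_generates_imp_less:
  assumes "0 < m0" and m: "\<And>i. i \<le> n \<Longrightarrow> m i = m0 + i * d"
    and min: "minimally_generates m {..n} (semigroup_gen m {..n})"
  shows "n < m0"
proof (rule ccontr)
  assume "\<not> n < m0"
  then have m0: "m0 \<in> {..n}" "0 \<in> {..n} - {m0}" using assms(1) by auto
  have "semigroup_gen m {..n} \<subseteq> semigroup_gen m ({..n} - {m0})"
  proof
    fix x assume "x \<in> semigroup_gen m {..n}"
    then obtain c where c: "x = (\<Sum>i \<le> n. c i * m i)" by (auto simp: semigroup_gen_def)
    define c' where "c' = c(0 := c 0 + c m0 * (1 + d))"
    have "x = c m0 * m m0 + (c 0 * m 0 + (\<Sum>i \<in> {..n} - {m0} - {0}. c i * m i))"
      using m0 by (simp add: c sum.remove[of "{..n}" m0] sum.remove[of "{..n} - {m0}" 0])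
    also have "c m0 * m m0 = c m0 * (1 + d) * m 0"
      using m0 m by (simp add: algebra_simps)
    also have "\<dots> + (c 0 * m 0 + (\<Sum>i \<in> {..n} - {m0} - {0}. c i * m i))
        = c' 0 * m 0 + (\<Sum>i \<in> {..n} - {m0} - {0}. c' i * m i)"
      by (simp add: c'_def algebra_simps)
    also have "\<dots> = (\<Sum>i \<in> {..n} - {m0}. c' i * m i)"
      using m0 by (simp add: sum.remove[of "{..n} - {m0}" 0])
    finally show "x \<in> semigroup_gen m ({..n} - {m0})" by (auto simp: semigroup_gen_def)
  qed
  moreover have "semigroup_gen m ({..n} - {m0}) \<subseteq> semigroup_gen m {..n}"
  proof
    fix x assume "x \<in> semigroup_gen m ({..n} - {m0})"
    then obtain c where c: "x = (\<Sum>i \<in> {..n} - {m0}. c i * m i)" by (auto simp: semigroup_gen_def)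
    have "x = (\<Sum>i \<le> n. (c(m0 := 0)) i * m i)"
      using m0(1) by (simp add: c sum.remove[of "{..n}" m0])
    then show "x \<in> semigroup_gen m {..n}" unfolding semigroup_gen_def by blast
  qed
  moreover have "{..n} - {m0} \<subset> {..n}" using m0 by blast
  ultimately show False using min unfolding minimally_generates_def by blast
qed

theorem theorem18:
  fixes n m0 d l :: nat and m :: "nat \<Rightarrow> nat"
    and P :: "'a::field mpoly set"
  assumes "n \<ge> 2" and "m0 > 0" and "d > 0"
    and "\<And>i. i \<le> n \<Longrightarrow> m i = m0 + i * d"
    and "Gcd (m ` {..n}) = 1"
    and "minimally_generates m {..n} (semigroup_gen m {..n})"
    and "P = defining_ideal n m"
    and "l > 0"
  shows "ratliff_rush (mpoly_ring n) (ideal_pow (mpoly_ring n) (initial_ideal n m P) l)"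
proof -
  have "n < m0" using assms(2,4,6) by (rule minimally_generates_imp_less)
  \<comment> \<open>The shift by one puts the remainder into \<open>{1..n}\<close> instead of \<open>{0..<n}\<close>.\<close>
  define q where "q = (m0 - 1) div n"
  define r where "r = (m0 - 1) mod n + 1"
  have m0_eq: "m0 = q * n + r"
    using assms(2) div_mult_mod_eq[of "m0 - 1" n] by (simp add: q_def r_def)
  have r: "0 < r" "r \<le> n" using assms(1) by (auto simp: r_def Suc_le_eq)
  have "0 < q" using \<open>n < m0\<close> assms(1) by (simp add: q_def div_greater_zero_iff)
  have "gcd m0 d dvd Gcd (m ` {..n})" by (rule Gcd_greatest) (auto simp: assms(4))
  then have "coprime m0 d" using assms(5) by (simp add: coprime_iff_gcd_eq_1)
  then interpret arithmetic_sequence n m0 d q r m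
    using r \<open>0 < q\<close> m0_eq assms(4) by unfold_locales
  show ?thesis
    unfolding assms(7) initial_ideal_eq ideal_pow_monomial_ideal_pow_exps[OF r]
    using r q by (rule ratliff_rush_pow_exps)
qed

end
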